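(* Let $G_1$ and $G_2$ be two connected non-bipartite finite simple graphs, each with $n$ vertices and $m$ edges, and let $\mu_n^+$ and $\lambda_n^+$ be the smallest signless Laplacian eigenvalues of $G_1$ and $G_2$ respectively. Let $p$ be an integer with $p\ge n+2$, and suppose $\min(\mu_n^+,\lambda_n^+)\ge\frac{2m}{n}-2$. Then $LE(G_1^*\times K_p)=LE(G_2^*\times K_p)$ if and only if $LE(G_1)=LE(G_2)$.
   Context: With $A$ the adjacency matrix and $D$ the diagonal degree matrix, Laplacian eigenvalues are those of $D-A$ and signless Laplacian eigenvalues those of $D+A$. The Laplacian energy of a graph $H$ with $N$ vertices, $M$ edges and Laplacian eigenvalues $\nu_1,\dots,\nu_N$ is $LE(H)=\sum_{i=1}^N|\nu_i-\frac{2M}{N}|$. For $G$ with vertex set $\{v_1,\dots,v_n\}$, the extended double cover $G^*$ is the bipartite graph with parts $X=\{x_1,\dots,x_n\}$, $Y=\{y_1,\dots,y_n\}$, where $x_i$ is adjacent to $y_j$ iff $i=j$ or $v_i$ is adjacent to $v_j$ in $G$. The Cartesian product $H_1\times H_2$ has vertex set $V(H_1)\times V(H_2)$, with $(u_1,w_1)$ adjacent to $(u_2,w_2)$ iff either $u_1=u_2$ and $w_1w_2$ is an edge of $H_2$, or $w_1=w_2$ and $u_1u_2$ is an edge of $H_1$. $K_p$ is the complete graph on $p$ vertices. *)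

theory Defs
  imports
    "Graph_Theory.Graph_Theory"
    "Jordan_Normal_Form.Char_Poly"
begin

text \<open>
  A finite simple graph is a \<open>pair_graph\<close>: a finite, loopless, symmetric set of arcs on a
  finite vertex set. The edge \<open>uv\<close> is represented by the two arcs \<open>(u, v)\<close> and \<open>(v, u)\<close>; hence
  the degree of a vertex is its out-degree, but edges have to be counted as unordered pairs.
\<close>

definition num_verts :: "'a pair_pre_digraph \<Rightarrow> nat" where
  "num_verts G = card (pverts G)"

definition num_edges :: "'a pair_pre_digraph \<Rightarrow> nat" where
  "num_edges G = card ((\<lambda>(u, v). {u, v}) ` parcs G)"

definition bipartite :: "'a pair_pre_digraph \<Rightarrow> bool" where
  "bipartite G \<longleftrightarrow>
    (\<exists>X Y. X \<union> Y = pverts G \<and> X \<inter> Y = {} \<and> parcs G \<subseteq> X \<times> Y \<union> Y \<times> X)"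

text \<open>
  The matrices refer to an arbitrary but fixed enumeration of the vertices. Another enumeration
  conjugates them by a permutation matrix, so the spectra do not depend on the choice.
\<close>

definition vertex_list :: "'a pair_pre_digraph \<Rightarrow> 'a list" where
  "vertex_list G = (SOME vs. distinct vs \<and> set vs = pverts G)"

lemma vertex_list:
  assumes "finite (pverts G)"
  shows "distinct (vertex_list G)" "set (vertex_list G) = pverts G"
    "length (vertex_list G) = num_verts G"
proof -
  have "distinct (vertex_list G) \<and> set (vertex_list G) = pverts G"
    unfolding vertex_list_def by (rule someI_ex) (use finite_distinct_list[OF assms] in blast)
  then show "distinct (vertex_list G)" "set (vertex_list G) = pverts G"
    "length (vertex_list G) = num_verts G"
    using distinct_card[of "vertex_list G"] by (auto simp: num_verts_def)
qed

definition adjacency_matrix :: "'a pair_pre_digraph \<Rightarrow> real mat" where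
  "adjacency_matrix G = mat (num_verts G) (num_verts G)
    (\<lambda>(i, j). if (vertex_list G ! i, vertex_list G ! j) \<in> parcs G then 1 else 0)"

definition degree_matrix :: "'a pair_pre_digraph \<Rightarrow> real mat" where
  "degree_matrix G = mat (num_verts G) (num_verts G)
    (\<lambda>(i, j). if i = j then real (out_degree (with_proj G) (vertex_list G ! i)) else 0)"

text \<open>
  Eigenvalues are counted with algebraic multiplicity. Real roots suffice, since the matrices are
  real symmetric.
\<close>

definition laplacian_eigenvalues :: "'a pair_pre_digraph \<Rightarrow> real multiset" where
  "laplacian_eigenvalues G = proots (char_poly (degree_matrix G - adjacency_matrix G))"

definition signless_laplacian_eigenvalues :: "'a pair_pre_digraph \<Rightarrow> real multiset" where
  "signless_laplacian_eigenvalues G = proots (char_poly (degree_matrix G + adjacency_matrix G))"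

definition smallest_signless_eigenvalue :: "'a pair_pre_digraph \<Rightarrow> real" where
  "smallest_signless_eigenvalue G = Min (set_mset (signless_laplacian_eigenvalues G))"

definition laplacian_energy :: "'a pair_pre_digraph \<Rightarrow> real" where
  "laplacian_energy H =
    (\<Sum>\<nu>\<in>#laplacian_eigenvalues H. \<bar>\<nu> - 2 * real (num_edges H) / real (num_verts H)\<bar>)"

text \<open>The vertices \<open>x\<^sub>i\<close> and \<open>y\<^sub>i\<close> are \<open>Inl v\<^sub>i\<close> and \<open>Inr v\<^sub>i\<close>.\<close>

definition extended_double_cover :: "'a pair_pre_digraph \<Rightarrow> ('a + 'a) pair_pre_digraph" where
  "extended_double_cover G =
    \<lparr> pverts = pverts G <+> pverts G,
      parcs =
        {(Inl u, Inr v) | u v. u \<in> pverts G \<and> v \<in> pverts G \<and> (u = v \<or> (u, v) \<in> parcs G)} \<union>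
        {(Inr v, Inl u) | u v. u \<in> pverts G \<and> v \<in> pverts G \<and> (u = v \<or> (u, v) \<in> parcs G)} \<rparr>"

definition cartesian_product ::
    "'a pair_pre_digraph \<Rightarrow> 'b pair_pre_digraph \<Rightarrow> ('a \<times> 'b) pair_pre_digraph" where
  "cartesian_product H1 H2 =
    \<lparr> pverts = pverts H1 \<times> pverts H2,
      parcs = {((u1, w1), (u2, w2)) | u1 w1 u2 w2.
        (u1 \<in> pverts H1 \<and> u1 = u2 \<and> (w1, w2) \<in> parcs H2) \<or>
        (w1 \<in> pverts H2 \<and> w1 = w2 \<and> (u1, u2) \<in> parcs H1)} \<rparr>"

lemma pair_graphI_rel:
  assumes "finite (pverts G)" "parcs G \<subseteq> pverts G \<times> pverts G"
    and "sym (parcs G)" "irrefl (parcs G)"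
  shows "pair_graph G"
proof -
  have f: "finite (parcs G)" using assms(1,2) by (meson finite_SigmaI finite_subset)
  have s: "symmetric (with_proj G)" using assms(3) by (simp add: symmetric_def)
  show ?thesis by unfold_locales (use assms f s in \<open>auto simp: irrefl_def\<close>)
qed

lemma pair_graph_extended_double_cover:
  assumes "pair_graph G"
  shows "pair_graph (extended_double_cover G)"
proof -
  interpret pair_graph G by fact
  show ?thesis
  proof (rule pair_graphI_rel)
    show "finite (pverts (extended_double_cover G))"
      using pair_finite_verts by (simp add: extended_double_cover_def)
    show "sym (parcs (extended_double_cover G))"
      unfolding sym_def extended_double_cover_def by simp blast
  qed (auto simp: extended_double_cover_def irrefl_def)
qed

lemma pair_graph_cartesian_product:
  assumes "pair_graph H1" "pair_graph H2"
  shows "pair_graph (cartesian_product H1 H2)"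
proof -
  interpret H1: pair_graph H1 by fact
  interpret H2: pair_graph H2 by fact
  have s1: "sym (parcs H1)" and s2: "sym (parcs H2)"
    using H1.pair_sym_arcs H2.pair_sym_arcs by (simp_all add: symmetric_def)
  show ?thesis
  proof (rule pair_graphI_rel)
    show "finite (pverts (cartesian_product H1 H2))"
      using H1.pair_finite_verts H2.pair_finite_verts by (simp add: cartesian_product_def)
    show "parcs (cartesian_product H1 H2)
        \<subseteq> pverts (cartesian_product H1 H2) \<times> pverts (cartesian_product H1 H2)"
      using H1.in_arcsD1 H1.in_arcsD2 H2.in_arcsD1 H2.in_arcsD2
      by (auto simp: cartesian_product_def)
    show "sym (parcs (cartesian_product H1 H2))"
      using s1 s2 unfolding sym_def cartesian_product_def by auto
    show "irrefl (parcs (cartesian_product H1 H2))"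
      using H1.pair_no_loops H2.pair_no_loops unfolding irrefl_def cartesian_product_def
      by fastforce
  qed
qed
end

theory Submission
  imports Defs "Jordan_Normal_Form.Spectral_Radius"
begin

text \<open>
  Why the theorem holds. Let \<open>G\<close> have \<open>n\<close> vertices and average degree \<open>a\<close>, Laplacian eigenvalues
  \<open>\<mu>\<^sub>i\<close> and signless Laplacian eigenvalues \<open>q\<^sub>i\<close>. On the extended double cover, vectors with equal
  values on the two copies of a vertex see the Laplacian of \<open>G\<close>, and vectors with opposite values
  see the signless Laplacian shifted by \<open>2\<close>; so the cover has the Laplacian eigenvalues \<open>\<mu>\<^sub>i\<close> and
  \<open>q\<^sub>i + 2\<close>. The Laplacian of a Cartesian product is the Kronecker sum of the two Laplacians, so its
  eigenvalues are the sums of one eigenvalue from each factor, and \<open>K\<^sub>p\<close> contributes \<open>0\<close> once and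
  \<open>p\<close> with multiplicity \<open>p - 1\<close>. The product has average degree \<open>a + p\<close>. Its Laplacian energy is
  therefore the sum over \<open>i\<close> of
  \<open>\<bar>\<mu>\<^sub>i - (a + p)\<bar> + (p - 1) \<bar>\<mu>\<^sub>i - a\<bar> + \<bar>q\<^sub>i + 2 - (a + p)\<bar> + (p - 1) \<bar>q\<^sub>i + 2 - a\<bar>\<close>.

  All absolute values except those of \<open>\<mu>\<^sub>i - a\<close> have a known sign. The lower bound on the smallest
  signless eigenvalue says \<open>q\<^sub>i + 2 \<ge> a\<close>. In the other direction both spectra are bounded by
  \<open>a + n - 1\<close> (\<open>eigenvalue_le\<close>), which is at most \<open>a + p - 2\<close>. Since the \<open>\<mu>\<^sub>i\<close> and the
  \<open>q\<^sub>i\<close> both sum to \<open>n a\<close>, what remains is \<open>(p - 1) (LE(G) + 4 n)\<close>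
  (\<open>laplacian_energy_double_cover_times_complete\<close>). As \<open>n\<close> and \<open>p > 1\<close> are common to both graphs,
  this is an injective function of \<open>LE(G)\<close>.

  The spectra are handled through orthonormal bases of eigenvectors, written as functions on the
  vertex set. They exist by the spectral theorem for real symmetric matrices, they determine the
  multiset of roots of the characteristic polynomial (\<open>eigenbasis_spectrum\<close>), whichever enumeration
  of the vertices defines the matrix, and bases for the cover and the product are written down
  from bases of the constituents, so that no characteristic polynomial of a block or
  Kronecker matrix has to be computed.
\<close>

section \<open>The spectral theorem for real symmetric matrices\<close>

text \<open>
  The reflection that swaps \<open>v\<close> and the first unit vector. When \<open>v\<close> is already that unit vector,
  the direction \<open>w\<close> vanishes and \<open>c = 1 / 0 = 0\<close>, so the formula gives the identity matrix.
\<close>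

lemma householder_reflection:
  fixes v :: "real vec"
  assumes v: "v \<in> carrier_vec n" and n: "0 < n" and unit: "v \<bullet> v = 1"
  obtains H where "H \<in> carrier_mat n n" "H\<^sup>T = H" "H * H = 1\<^sub>m n" "col H 0 = v"
proof -
  define w where "w i = v $ i - (if i = 0 then 1 else 0)" for i
  define c where "c = 1 / (1 - v $ 0)"
  define H where "H = mat n n (\<lambda>(i, j). (if i = j then 1 else 0) - c * w i * w j)"
  have H: "H \<in> carrier_mat n n" by (simp add: H_def)
  have sq: "(\<Sum>i<n. (v $ i)\<^sup>2) = 1"
    using unit v by (simp add: scalar_prod_def power2_eq_square atLeast0LessThan)
  have ww: "(\<Sum>k<n. w k * w k) = 2 * (1 - v $ 0)"
  proof -
    have "(\<Sum>k<n. w k * w k) =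
        (\<Sum>k<n. (v $ k)\<^sup>2 - 2 * (if k = 0 then v $ k else 0) + (if k = 0 then 1 else 0))"
      by (intro sum.cong) (auto simp: w_def power2_eq_square algebra_simps)
    also have "\<dots> = 1 - 2 * v $ 0 + 1"
      using n by (simp add: sum.distrib sum_subtractf sq flip: sum_distrib_left)
    finally show ?thesis by simp
  qed
  have w0: "w k = 0" if "v $ 0 = 1" "k < n" for k
  proof -
    have "(\<Sum>k<n. w k * w k) = 0" using ww that by simp
    then show ?thesis using that by (subst (asm) sum_nonneg_eq_0_iff) auto
  qed
  have "H * H = 1\<^sub>m n"
  proof (rule eq_matI)
    fix i j assume "i < dim_row (1\<^sub>m n)" "j < dim_col (1\<^sub>m n)"
    then have ij: "i < n" "j < n" by auto
    have "(H * H) $$ (i, j) =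
        (\<Sum>k<n. ((if i = k then 1 else 0) - c * w i * w k) * ((if k = j then 1 else 0) - c * w k * w j))"
      using ij by (simp add: H_def scalar_prod_def atLeast0LessThan)
    also have "\<dots> = (\<Sum>k<n. (if k = i then if i = j then 1 else 0 else 0)
        - c * w j * (if k = i then w k else 0) - c * w i * (if k = j then w k else 0)
        + c * c * w i * w j * (w k * w k))"
      by (intro sum.cong) (auto simp: algebra_simps)
    also have "\<dots> = (if i = j then 1 else 0) - 2 * c * w i * w j
        + c * c * w i * w j * (2 * (1 - v $ 0))"
      using ij by (simp add: sum.distrib sum_subtractf ww flip: sum_distrib_left)
    also have "\<dots> = (if i = j then 1 else 0)"
    proof (cases "v $ 0 = 1")
      case True
      then show ?thesis by (simp add: c_def)
    next
      case False
      then have "c * (1 - v $ 0) = 1" by (simp add: c_def)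
      moreover have "c * c * w i * w j * (2 * (1 - v $ 0)) = 2 * c * w i * w j * (c * (1 - v $ 0))"
        by simp
      ultimately show ?thesis by simp
    qed
    finally show "(H * H) $$ (i, j) = 1\<^sub>m n $$ (i, j)" using ij by simp
  qed (use H in auto)
  moreover have "col H 0 = v"
  proof (rule eq_vecI)
    fix i assume "i < dim_vec v"
    then have i: "i < n" using v by simp
    have "c * w i * w 0 = - w i"
    proof (cases "v $ 0 = 1")
      case True
      then show ?thesis using w0[OF True i] by simp
    next
      case False
      then have "c * w 0 = - 1" by (simp add: c_def w_def field_simps)
      moreover have "c * w i * w 0 = w i * (c * w 0)" by simp
      ultimately show ?thesis by simp
    qed
    then show "col H 0 $ i = v $ i" using i n by (simp add: H_def w_def)
  qed (use H v in auto)
  moreover have "H\<^sup>T = H" by (rule eq_matI) (auto simp: H_def)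
  ultimately show ?thesis using that H by blast
qed

text \<open>
  Over the complex numbers an eigenvalue \<open>k\<close> exists. For an eigenvector \<open>z\<close> the form
  \<open>z\<^sup>* A z = k \<bar>z\<bar>\<^sup>2\<close> equals its own conjugate because \<open>A\<close> is real and symmetric; hence \<open>k\<close> is real,
  and as a root of the real characteristic polynomial it has a real eigenvector as well.
\<close>

lemma symmetric_real_eigenvector:
  fixes A :: "real mat"
  assumes A: "A \<in> carrier_mat n n" and sym: "A\<^sup>T = A" and n: "0 < n"
  obtains v l where "v \<in> carrier_vec n" "v \<bullet> v = 1" "A *\<^sub>v v = l \<cdot>\<^sub>v v"
proof -
  define C where "C = map_mat complex_of_real A"
  have C: "C \<in> carrier_mat n n" using A by (simp add: C_def)
  obtain k where k: "eigenvalue C k"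
    using spectrum_non_empty[OF C n] by (auto simp: spectrum_def)
  then obtain z where z: "z \<in> carrier_vec n" "z \<noteq> 0\<^sub>v n" "C *\<^sub>v z = k \<cdot>\<^sub>v z"
    using C by (auto simp: eigenvalue_def eigenvector_def)
  have row: "(\<Sum>j<n. of_real (A $$ (i, j)) * z $ j) = k * z $ i" if "i < n" for i
    using arg_cong[OF z(3), of "\<lambda>x. x $ i"] that A z(1)
    by (simp add: C_def scalar_prod_def atLeast0LessThan)
  have symA: "A $$ (i, j) = A $$ (j, i)" if "i < n" "j < n" for i j
    using arg_cong[OF sym, of "\<lambda>M. M $$ (i, j)"] that A by simp
  define N where "N = (\<Sum>i<n. (cmod (z $ i))\<^sup>2)"
  define S where "S = (\<Sum>i<n. cnj (z $ i) * (k * z $ i))"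
  have S: "S = k * of_real N"
    by (simp add: S_def N_def sum_distrib_left complex_norm_square ac_simps del: of_real_power)
  have "cnj S = S"
  proof -
    have S2: "S = (\<Sum>i<n. \<Sum>j<n. of_real (A $$ (i, j)) * cnj (z $ i) * z $ j)"
      unfolding S_def by (intro sum.cong refl) (simp add: row[symmetric] sum_distrib_left ac_simps)
    have "cnj S = (\<Sum>i<n. \<Sum>j<n. of_real (A $$ (i, j)) * z $ i * cnj (z $ j))"
      by (simp add: S2)
    also have "\<dots> = (\<Sum>j<n. \<Sum>i<n. of_real (A $$ (i, j)) * z $ i * cnj (z $ j))"
      by (rule sum.swap)
    also have "\<dots> = S"
      unfolding S2 by (intro sum.cong refl) (auto simp: symA)
    finally show ?thesis .
  qed
  obtain i where i: "i < n" "z $ i \<noteq> 0" using z by (metis carrier_vecD eq_vecI index_zero_vec)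
  have "N > 0"
    unfolding N_def by (rule sum_pos2[of _ i]) (use i in auto)
  with \<open>cnj S = S\<close> S have "cnj k = k" by simp
  then have kr: "k = of_real (Re k)" by (simp add: complex_eq_iff)
  have "poly (char_poly C) k = 0" using k eigenvalue_root_char_poly[OF C] by simp
  then have "poly (map_poly complex_of_real (char_poly A)) (of_real (Re k)) = 0"
    using of_real_hom.char_poly_hom[OF A] kr by (metis C_def)
  then have "poly (char_poly A) (Re k) = 0" by simp
  then obtain y where y: "y \<in> carrier_vec n" "y \<noteq> 0\<^sub>v n" "A *\<^sub>v y = Re k \<cdot>\<^sub>v y"
    using eigenvalue_root_char_poly[OF A] A by (auto simp: eigenvalue_def eigenvector_def)
  have pos: "y \<bullet> y > 0"
  proof -
    obtain i where i: "i < n" "y $ i \<noteq> 0" using y by (metis carrier_vecD eq_vecI index_zero_vec)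
    then have "0 < (\<Sum>i<n. y $ i * y $ i)" by (intro sum_pos2[of _ i]) (auto simp: zero_less_mult_iff)
    then show ?thesis using y(1) by (simp add: scalar_prod_def atLeast0LessThan)
  qed
  define r where "r = 1 / sqrt (y \<bullet> y)"
  have r: "r * (r * (y \<bullet> y)) = 1" using pos by (simp add: r_def)
  show ?thesis
  proof
    show "r \<cdot>\<^sub>v y \<in> carrier_vec n" using y by simp
    show "(r \<cdot>\<^sub>v y) \<bullet> (r \<cdot>\<^sub>v y) = 1" using y r by simp
    show "A *\<^sub>v (r \<cdot>\<^sub>v y) = Re k \<cdot>\<^sub>v (r \<cdot>\<^sub>v y)"
      using y A by (simp add: mult_mat_vec smult_smult_assoc mult.commute)
  qed
qed

text \<open>
  Conjugating by a reflection \<open>H\<close> whose first column is a unit eigenvector makes the first column of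
  \<open>H A H\<close> a multiple of the first unit vector. By symmetry the first row has the same shape, so the
  matrix splits into two diagonal blocks and the larger one is diagonalised by induction.
\<close>

lemma spectral_theorem_matrix:
  fixes A :: "real mat"
  assumes "A \<in> carrier_mat n n" "A\<^sup>T = A"
  shows "\<exists>P D. P \<in> carrier_mat n n \<and> D \<in> carrier_mat n n \<and> diagonal_mat D
    \<and> P\<^sup>T * P = 1\<^sub>m n \<and> A * P = P * D"
  using assms
proof (induction n arbitrary: A)
  case 0
  then show ?case
    by (intro exI[of _ "1\<^sub>m 0"]) (auto simp: diagonal_mat_def intro!: eq_matI)
next
  case (Suc n A)
  note A = Suc.prems(1) and symA = Suc.prems(2)
  obtain v l where v: "v \<in> carrier_vec (Suc n)" "v \<bullet> v = 1" "A *\<^sub>v v = l \<cdot>\<^sub>v v"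
    using symmetric_real_eigenvector[OF A symA] by auto
  obtain H where H: "H \<in> carrier_mat (Suc n) (Suc n)" "H\<^sup>T = H" "H * H = 1\<^sub>m (Suc n)" "col H 0 = v"
    using householder_reflection[OF v(1) _ v(2)] by blast
  define B where "B = H * A * H"
  have B: "B \<in> carrier_mat (Suc n) (Suc n)" using H A by (simp add: B_def)
  have symB: "B\<^sup>T = B"
    using H A symA by (simp add: B_def transpose_mult[of _ "Suc n" "Suc n" _ "Suc n"]
        assoc_mult_mat[of _ "Suc n" "Suc n" _ "Suc n" _ "Suc n"])
  have AH: "A * H = H * B"
  proof -
    have "H * B = (H * H) * (A * H)"
      unfolding B_def
      using H(1) A by (simp add: assoc_mult_mat[of _ "Suc n" "Suc n" _ "Suc n" _ "Suc n"])
    then show ?thesis using H A by simp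
  qed
  have colB: "col B 0 = l \<cdot>\<^sub>v unit_vec (Suc n) 0"
  proof -
    have Hv: "H *\<^sub>v v = unit_vec (Suc n) 0"
    proof -
      have "col (H * H) 0 = H *\<^sub>v col H 0"
        by (rule col_mult2[OF H(1) H(1)]) simp
      then show ?thesis by (simp add: H(3,4))
    qed
    have "col B 0 = (H * A) *\<^sub>v col H 0"
      unfolding B_def using H(1) A by (intro col_mult2[of _ "Suc n" "Suc n" _ "Suc n"]) auto
    then have "col B 0 = H *\<^sub>v (A *\<^sub>v v)"
      using H(1) A v(1) by (simp add: H(4) assoc_mult_mat_vec[of _ "Suc n" "Suc n" _ "Suc n"])
    then show ?thesis using v H Hv by (simp add: mult_mat_vec)
  qed
  obtain B1 B2 B3 B4 where sb: "split_block B 1 1 = (B1, B2, B3, B4)" by (metis prod_cases4)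
  from split_block[OF sb, of n n] B
  have Bs: "B1 \<in> carrier_mat 1 1" "B2 \<in> carrier_mat 1 n" "B3 \<in> carrier_mat n 1"
      "B4 \<in> carrier_mat n n" and Bb: "B = four_block_mat B1 B2 B3 B4" by auto
  have B0: "B $$ (i, 0) = 0" "B $$ (0, i) = 0" if "0 < i" "i < Suc n" for i
  proof -
    show 1: "B $$ (i, 0) = 0"
      using arg_cong[OF colB, of "\<lambda>x. x $ i"] that B by simp
    show "B $$ (0, i) = 0"
      using 1 arg_cong[OF symB, of "\<lambda>M. M $$ (0, i)"] that B by simp
  qed
  have "B2 = 0\<^sub>m 1 n" "B3 = 0\<^sub>m n 1"
    using B sb B0 unfolding split_block_def Let_def by (auto intro!: eq_matI)
  with Bb have Bb: "B = four_block_mat B1 (0\<^sub>m 1 n) (0\<^sub>m n 1) B4" by simp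
  have "B4\<^sup>T = B4"
  proof (rule eq_matI)
    fix i j assume "i < dim_row B4" "j < dim_col B4"
    then have ij: "i < n" "j < n" using Bs by auto
    have "B $$ (Suc j, Suc i) = B $$ (Suc i, Suc j)"
      using arg_cong[OF symB, of "\<lambda>M. M $$ (Suc i, Suc j)"] ij B by simp
    then show "B4\<^sup>T $$ (i, j) = B4 $$ (i, j)"
      using ij Bs by (simp add: Bb)
  qed (use Bs in auto)
  from Suc.IH[OF Bs(4) this] obtain P D where
    PD: "P \<in> carrier_mat n n" "D \<in> carrier_mat n n" "diagonal_mat D" "P\<^sup>T * P = 1\<^sub>m n" "B4 * P = P * D"
    by blast
  define Q where "Q = four_block_mat (1\<^sub>m 1) (0\<^sub>m 1 n) (0\<^sub>m n 1) P"
  define E where "E = four_block_mat B1 (0\<^sub>m 1 n) (0\<^sub>m n 1) D"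
  have Q: "Q \<in> carrier_mat (Suc n) (Suc n)" and E: "E \<in> carrier_mat (Suc n) (Suc n)"
    using PD Bs by (auto simp: Q_def E_def)
  have QQ: "Q\<^sup>T * Q = 1\<^sub>m (Suc n)"
    using PD four_block_one_mat[of 1 n]
    by (simp add: Q_def transpose_four_block_mat[of _ 1 1 _ n _ n]
        mult_four_block_mat[of _ 1 1 _ n _ n _ _ 1 _ n])
  have BQ: "B * Q = Q * E"
    unfolding Bb Q_def E_def using PD Bs
    by (simp add: mult_four_block_mat[of _ 1 1 _ n _ n _ _ 1 _ n])
  have "diagonal_mat E"
    using PD(2,3) Bs(1) by (auto simp: diagonal_mat_def E_def)
  moreover have "(H * Q)\<^sup>T * (H * Q) = 1\<^sub>m (Suc n)"
  proof -
    have "(H * Q)\<^sup>T * (H * Q) = (Q\<^sup>T * H) * (H * Q)"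
      using transpose_mult[OF H(1) Q] by (simp add: H(2))
    also have "\<dots> = Q\<^sup>T * (H * (H * Q))"
      using H(1) Q by (intro assoc_mult_mat[of _ "Suc n" "Suc n" _ "Suc n" _ "Suc n"]) auto
    also have "H * (H * Q) = Q"
      using assoc_mult_mat[OF H(1) H(1) Q] Q by (simp add: H(3))
    finally show ?thesis by (simp add: QQ)
  qed
  moreover have "A * (H * Q) = (H * Q) * E"
  proof -
    have "A * (H * Q) = (A * H) * Q"
      by (rule assoc_mult_mat[OF A H(1) Q, symmetric])
    also have "\<dots> = H * (B * Q)"
      unfolding AH by (rule assoc_mult_mat[OF H(1) B Q])
    also have "\<dots> = (H * Q) * E"
      unfolding BQ by (rule assoc_mult_mat[OF H(1) Q E, symmetric])
    finally show ?thesis .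
  qed
  ultimately show ?case using H(1) Q E by (intro exI[of _ "H * Q"] exI[of _ E]) auto
qed

section \<open>Orthonormal eigenbases on a finite index set\<close>

text \<open>
  The basis vectors \<open>e j\<close> and the eigenvalues \<open>l j\<close> are indexed by the coordinates themselves. Thus
  there is automatically the right number of them, and the basis of a graph on \<open>V <+> V\<close> or on
  \<open>V \<times> W\<close> has the index set that its construction from smaller bases suggests.
\<close>

definition eigenbasis ::
    "'v set \<Rightarrow> ('v \<Rightarrow> 'v \<Rightarrow> real) \<Rightarrow> ('v \<Rightarrow> 'v \<Rightarrow> real) \<Rightarrow> ('v \<Rightarrow> real) \<Rightarrow> bool" where
  "eigenbasis V f e l \<longleftrightarrow>
    (\<forall>i\<in>V. \<forall>j\<in>V. (\<Sum>v\<in>V. e i v * e j v) = (if i = j then 1 else 0)) \<and>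
    (\<forall>j\<in>V. \<forall>u\<in>V. (\<Sum>v\<in>V. f u v * e j v) = l j * e j u)"

lemma eigenbasis_orthonormal:
  "eigenbasis V f e l \<Longrightarrow> i \<in> V \<Longrightarrow> j \<in> V \<Longrightarrow> (\<Sum>v\<in>V. e i v * e j v) = (if i = j then 1 else 0)"
  by (simp add: eigenbasis_def)

lemma eigenbasis_eigen:
  "eigenbasis V f e l \<Longrightarrow> j \<in> V \<Longrightarrow> u \<in> V \<Longrightarrow> (\<Sum>v\<in>V. f u v * e j v) = l j * e j u"
  by (simp add: eigenbasis_def)

lemma sum_list_positions:
  "distinct vs \<Longrightarrow> (\<Sum>v\<in>set vs. g v) = (\<Sum>i<length vs. g (vs ! i))"
  by (rule sum.reindex_bij_betw[symmetric, OF bij_betw_nth]) auto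

lemma eigenbasis_exists:
  assumes "finite V" and sym: "\<And>u v. u \<in> V \<Longrightarrow> v \<in> V \<Longrightarrow> f u v = f v u"
  obtains e l where "eigenbasis V f e l"
proof -
  obtain vs where vs: "distinct vs" "set vs = V"
    using finite_distinct_list[OF assms(1)] by blast
  define n where "n = length vs"
  define A where "A = mat n n (\<lambda>(i, j). f (vs ! i) (vs ! j))"
  have A: "A \<in> carrier_mat n n" by (simp add: A_def)
  have "A\<^sup>T = A"
    by (rule eq_matI) (use vs in \<open>auto simp: A_def n_def intro: sym\<close>)
  from spectral_theorem_matrix[OF A this] obtain P D where
    PD: "P \<in> carrier_mat n n" "D \<in> carrier_mat n n" "diagonal_mat D" "P\<^sup>T * P = 1\<^sub>m n" "A * P = P * D"
    by blast
  define pos where "pos = inv_into {..<n} ((!) vs)"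
  have pos: "pos (vs ! i) = i" if "i < n" for i
    unfolding pos_def using that vs
    by (intro inv_into_f_f) (auto simp: inj_on_def nth_eq_iff_index_eq n_def)
  define e where "e j v = P $$ (pos v, pos j)" for j v
  define l where "l j = D $$ (pos j, pos j)" for j
  have sumV: "(\<Sum>v\<in>V. g v) = (\<Sum>i<n. g (vs ! i))" for g :: "'a \<Rightarrow> real"
    using sum_list_positions[OF vs(1), of g] vs(2) by (simp add: n_def)
  have V: "\<exists>i<n. v = vs ! i" if "v \<in> V" for v
    using that vs by (auto simp: in_set_conv_nth n_def)
  have "eigenbasis V f e l"
    unfolding eigenbasis_def
  proof (intro conjI ballI)
    fix x y assume "x \<in> V" "y \<in> V"
    with V obtain i j where ij: "i < n" "j < n" "x = vs ! i" "y = vs ! j" by blast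
    have "(\<Sum>v\<in>V. e x v * e y v) = (P\<^sup>T * P) $$ (i, j)"
      using ij PD(1) by (simp add: sumV e_def pos scalar_prod_def atLeast0LessThan)
    then show "(\<Sum>v\<in>V. e x v * e y v) = (if x = y then 1 else 0)"
      using ij vs by (simp add: PD nth_eq_iff_index_eq n_def)
    have "(\<Sum>v\<in>V. f y v * e x v) = (A * P) $$ (j, i)"
      using ij PD(1) by (simp add: A_def sumV e_def pos scalar_prod_def atLeast0LessThan)
    also have "\<dots> = (\<Sum>k<n. P $$ (j, k) * D $$ (k, i))"
      using ij PD(1,2) unfolding PD(5) by (simp add: scalar_prod_def atLeast0LessThan)
    also have "\<dots> = (\<Sum>k<n. if k = i then P $$ (j, k) * D $$ (i, i) else 0)"
      using ij PD(2,3) by (intro sum.cong refl) (auto simp: diagonal_mat_def)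
    also have "\<dots> = l x * e x y"
      using ij by (simp add: l_def e_def pos)
    finally show "(\<Sum>v\<in>V. f y v * e x v) = l x * e x y" .
  qed
  then show ?thesis by (rule that)
qed

text \<open>
  The matrix of the basis is square, so orthonormality of its columns gives orthonormality of its
  rows.
\<close>

lemma eigenbasis_complete:
  assumes "finite V" "eigenbasis V f e l" "u \<in> V" "v \<in> V"
  shows "(\<Sum>j\<in>V. e j u * e j v) = (if u = v then 1 else 0)"
proof -
  obtain vs where vs: "distinct vs" "set vs = V"
    using finite_distinct_list[OF assms(1)] by blast
  define n where "n = length vs"
  define P where "P = mat n n (\<lambda>(i, j). e (vs ! j) (vs ! i))"
  have P: "P \<in> carrier_mat n n" "P\<^sup>T \<in> carrier_mat n n" by (auto simp: P_def)
  have sumV: "(\<Sum>v\<in>V. g v) = (\<Sum>i<n. g (vs ! i))" for g :: "'a \<Rightarrow> real"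
    using sum_list_positions[OF vs(1), of g] vs(2) by (simp add: n_def)
  have "P\<^sup>T * P = 1\<^sub>m n"
  proof (rule eq_matI)
    fix i j assume "i < dim_row (1\<^sub>m n)" "j < dim_col (1\<^sub>m n)"
    then have ij: "i < n" "j < n" "vs ! i \<in> V" "vs ! j \<in> V" using vs by (auto simp: n_def)
    then have "(P\<^sup>T * P) $$ (i, j) = (\<Sum>v\<in>V. e (vs ! i) v * e (vs ! j) v)"
      by (simp add: P_def sumV scalar_prod_def atLeast0LessThan)
    then show "(P\<^sup>T * P) $$ (i, j) = 1\<^sub>m n $$ (i, j)"
      using ij vs eigenbasis_orthonormal[OF assms(2) ij(3,4)] by (simp add: nth_eq_iff_index_eq n_def)
  qed (use P in auto)
  then have PP: "P * P\<^sup>T = 1\<^sub>m n" by (rule mat_mult_left_right_inverse[OF P(2,1)])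
  obtain i j where ij: "i < n" "j < n" "u = vs ! i" "v = vs ! j"
    using assms(3,4) vs by (auto simp: in_set_conv_nth n_def)
  have "(\<Sum>j\<in>V. e j u * e j v) = (P * P\<^sup>T) $$ (i, j)"
    using ij by (simp add: P_def sumV scalar_prod_def atLeast0LessThan)
  then show ?thesis using ij vs unfolding PP by (simp add: nth_eq_iff_index_eq n_def)
qed

lemma eigenbasis_trace:
  assumes "finite V" "eigenbasis V f e l"
  shows "(\<Sum>j\<in>V. l j) = (\<Sum>v\<in>V. f v v)"
proof -
  have "(\<Sum>j\<in>V. l j) = (\<Sum>j\<in>V. \<Sum>u\<in>V. l j * e j u * e j u)"
    using eigenbasis_orthonormal[OF assms(2)]
    by (intro sum.cong refl) (simp add: mult.assoc flip: sum_distrib_left)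
  also have "\<dots> = (\<Sum>j\<in>V. \<Sum>u\<in>V. \<Sum>v\<in>V. f u v * (e j u * e j v))"
  proof (intro sum.cong refl)
    fix j u assume "j \<in> V" "u \<in> V"
    then have "l j * e j u * e j u = e j u * (\<Sum>v\<in>V. f u v * e j v)"
      using eigenbasis_eigen[OF assms(2)] by simp
    also have "\<dots> = (\<Sum>v\<in>V. f u v * (e j u * e j v))"
      by (simp add: sum_distrib_left mult.left_commute)
    finally show "l j * e j u * e j u = (\<Sum>v\<in>V. f u v * (e j u * e j v))" .
  qed
  also have "\<dots> = (\<Sum>u\<in>V. \<Sum>j\<in>V. \<Sum>v\<in>V. f u v * (e j u * e j v))"
    by (rule sum.swap)
  also have "\<dots> = (\<Sum>u\<in>V. \<Sum>v\<in>V. \<Sum>j\<in>V. f u v * (e j u * e j v))"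
    by (rule sum.cong[OF refl]) (rule sum.swap)
  also have "\<dots> = (\<Sum>u\<in>V. \<Sum>v\<in>V. f u v * (if u = v then 1 else 0))"
    by (intro sum.cong refl) (simp add: eigenbasis_complete[OF assms] flip: sum_distrib_left)
  also have "\<dots> = (\<Sum>v\<in>V. f v v)"
    using assms(1) by (simp add: if_distrib cong: if_cong)
  finally show ?thesis .
qed

text \<open>
  The matrix is similar to the diagonal matrix of the \<open>l j\<close>. The basis knows nothing about the
  enumeration \<open>vs\<close>, which makes the spectrum independent of it.
\<close>

lemma eigenbasis_spectrum:
  assumes vs: "distinct vs" "set vs = V" and eb: "eigenbasis V f e l"
  shows "proots (char_poly (mat (length vs) (length vs) (\<lambda>(i, j). f (vs ! i) (vs ! j))))
    = image_mset l (mset_set V)"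
proof -
  define n where "n = length vs"
  define A where "A = mat n n (\<lambda>(i, j). f (vs ! i) (vs ! j))"
  define P where "P = mat n n (\<lambda>(i, j). e (vs ! j) (vs ! i))"
  define D where "D = mat n n (\<lambda>(i, j). if i = j then l (vs ! i) else 0)"
  have c: "A \<in> carrier_mat n n" "D \<in> carrier_mat n n" "P \<in> carrier_mat n n" "P\<^sup>T \<in> carrier_mat n n"
    by (auto simp: A_def D_def P_def)
  have sumV: "(\<Sum>v\<in>V. g v) = (\<Sum>i<n. g (vs ! i))" for g :: "'a \<Rightarrow> real"
    using sum_list_positions[OF vs(1), of g] vs(2) by (simp add: n_def)
  have fin: "finite V" using vs by auto
  have inV: "vs ! i \<in> V" if "i < n" for i using that vs by (auto simp: n_def)
  have PP: "P * P\<^sup>T = 1\<^sub>m n"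
  proof (rule eq_matI)
    fix i j assume "i < dim_row (1\<^sub>m n)" "j < dim_col (1\<^sub>m n)"
    then have ij: "i < n" "j < n" by auto
    then have "(P * P\<^sup>T) $$ (i, j) = (\<Sum>k\<in>V. e k (vs ! i) * e k (vs ! j))"
      by (simp add: P_def sumV scalar_prod_def atLeast0LessThan)
    then show "(P * P\<^sup>T) $$ (i, j) = 1\<^sub>m n $$ (i, j)"
      using ij vs eigenbasis_complete[OF fin eb inV[OF ij(1)] inV[OF ij(2)]]
      by (simp add: nth_eq_iff_index_eq n_def)
  qed (use c in auto)
  have PP': "P\<^sup>T * P = 1\<^sub>m n" by (rule mat_mult_left_right_inverse[OF c(3,4) PP])
  have AP: "A * P = P * D"
  proof (rule eq_matI)
    fix i j assume "i < dim_row (P * D)" "j < dim_col (P * D)"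
    then have ij: "i < n" "j < n" using c by auto
    have "(A * P) $$ (i, j) = (\<Sum>v\<in>V. f (vs ! i) v * e (vs ! j) v)"
      using ij by (simp add: A_def P_def sumV scalar_prod_def atLeast0LessThan)
    also have "\<dots> = l (vs ! j) * e (vs ! j) (vs ! i)"
      by (rule eigenbasis_eigen[OF eb inV[OF ij(2)] inV[OF ij(1)]])
    also have "\<dots> = (P * D) $$ (i, j)"
      using ij by (simp add: P_def D_def scalar_prod_def atLeast0LessThan if_distrib cong: if_cong)
    finally show "(A * P) $$ (i, j) = (P * D) $$ (i, j)" .
  qed (use c in auto)
  have "A = A * (P * P\<^sup>T)"
    unfolding PP by (rule right_mult_one_mat[OF c(1), symmetric])
  also have "\<dots> = P * D * P\<^sup>T"
    unfolding AP[symmetric] by (rule assoc_mult_mat[OF c(1,3,4), symmetric])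
  finally have APD: "A = P * D * P\<^sup>T" .
  have "similar_mat A D"
    by (rule similar_matI[OF _ PP PP' APD]) (simp add: c)
  then have "char_poly A = char_poly D" by (rule char_poly_similar)
  also have "\<dots> = (\<Prod>a\<leftarrow>diag_mat D. [:- a, 1:])"
    by (rule char_poly_upper_triangular[OF c(2)]) (auto simp: D_def upper_triangular_def)
  also have "diag_mat D = map l vs"
    by (auto simp: diag_mat_def D_def n_def intro!: nth_equalityI)
  finally have "char_poly A = (\<Prod>p\<leftarrow>map (\<lambda>v. [:- l v, 1:]) vs. p)" by (simp add: comp_def)
  moreover have "proots \<dots> = (\<Sum>p\<leftarrow>map (\<lambda>v. [:- l v, 1:]) vs. proots p)"
    by (rule proots_prod_list) auto
  moreover have "\<dots> = image_mset l (mset vs)"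
    by (induction vs) auto
  moreover have "mset vs = mset_set V"
    using mset_set_set[OF vs(1)] vs(2) by simp
  ultimately have "proots (char_poly A) = image_mset l (mset_set V)" by metis
  then show ?thesis by (simp add: A_def n_def)
qed

section \<open>Laplacian spectra of a graph\<close>

definition adj :: "'a pair_pre_digraph \<Rightarrow> 'a \<Rightarrow> 'a \<Rightarrow> real" where
  "adj G u v = (if (u, v) \<in> parcs G then 1 else 0)"

definition deg :: "'a pair_pre_digraph \<Rightarrow> 'a \<Rightarrow> real" where
  "deg G u = (\<Sum>v\<in>pverts G. adj G u v)"

definition avg_degree :: "'a pair_pre_digraph \<Rightarrow> real" where
  "avg_degree G = (\<Sum>u\<in>pverts G. deg G u) / real (card (pverts G))"

text \<open>
  The matrix \<open>D + s A\<close>: the Laplacian for \<open>s = - 1\<close> and the signless Laplacian for \<open>s = 1\<close>.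
\<close>

definition signed_laplacian :: "real \<Rightarrow> 'a pair_pre_digraph \<Rightarrow> 'a \<Rightarrow> 'a \<Rightarrow> real" where
  "signed_laplacian s G u v = (if u = v then deg G u else 0) + s * adj G u v"

lemma adj_nonneg: "0 \<le> adj G u v" by (simp add: adj_def)

lemma deg_nonneg: "0 \<le> deg G u" by (simp add: deg_def sum_nonneg adj_nonneg)

lemma signed_laplacian_apply:
  assumes "finite (pverts G)" "u \<in> pverts G"
  shows "(\<Sum>v\<in>pverts G. signed_laplacian s G u v * x v)
    = deg G u * x u + s * (\<Sum>v\<in>pverts G. adj G u v * x v)"
proof -
  have "(\<Sum>v\<in>pverts G. signed_laplacian s G u v * x v)
      = (\<Sum>v\<in>pverts G. (if u = v then deg G u * x u else 0) + s * (adj G u v * x v))"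
    by (intro sum.cong refl) (simp add: signed_laplacian_def algebra_simps)
  then show ?thesis using assms by (simp add: sum.distrib sum_distrib_left)
qed

context pair_graph
begin

lemma parcs_sym: "(u, v) \<in> parcs G \<longleftrightarrow> (v, u) \<in> parcs G"
  using pair_sym_arcs by (auto simp: symmetric_def dest: symD)

lemma adj_sym: "adj G u v = adj G v u"
  using parcs_sym by (simp add: adj_def)

lemma adj_self: "adj G u u = 0"
  using pair_no_loops by (fastforce simp: adj_def)

lemma out_degree_eq_deg: "real (out_degree (with_proj G) u) = deg G u"
proof -
  have "out_arcs (with_proj G) u = Pair u ` {v \<in> pverts G. (u, v) \<in> parcs G}"
    using in_arcsD2 by (auto simp: out_arcs_def)
  then have "out_degree (with_proj G) u = card {v \<in> pverts G. (u, v) \<in> parcs G}"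
    by (simp add: out_degree_def card_image inj_on_def)
  then show ?thesis
    using pair_finite_verts by (simp add: deg_def adj_def sum.If_cases Int_def)
qed

lemma eigenbasis_signed_laplacian_exists:
  obtains e l where "eigenbasis (pverts G) (signed_laplacian s G) e l"
proof (rule eigenbasis_exists[OF pair_finite_verts, of "signed_laplacian s G"])
  show "signed_laplacian s G u v = signed_laplacian s G v u" for u v
    using adj_sym by (simp add: signed_laplacian_def)
qed (rule that)

lemma eigenbasis_signed_laplacian_trace:
  assumes "eigenbasis (pverts G) (signed_laplacian s G) e l"
  shows "(\<Sum>j\<in>pverts G. l j) = (\<Sum>u\<in>pverts G. deg G u)"
  using eigenbasis_trace[OF pair_finite_verts assms] by (simp add: signed_laplacian_def adj_self)

lemma laplacian_eigenvalues_eq: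
  assumes "eigenbasis (pverts G) (signed_laplacian (- 1) G) e l"
  shows "laplacian_eigenvalues G = image_mset l (mset_set (pverts G))"
proof -
  note vs = vertex_list[OF pair_finite_verts]
  have "degree_matrix G - adjacency_matrix G = mat (length (vertex_list G)) (length (vertex_list G))
      (\<lambda>(i, j). signed_laplacian (- 1) G (vertex_list G ! i) (vertex_list G ! j))"
    using vs by (intro eq_matI)
      (auto simp: degree_matrix_def adjacency_matrix_def signed_laplacian_def adj_def
        out_degree_eq_deg nth_eq_iff_index_eq)
  then show ?thesis
    using eigenbasis_spectrum[OF vs(1,2) assms] by (simp add: laplacian_eigenvalues_def)
qed

lemma signless_laplacian_eigenvalues_eq:
  assumes "eigenbasis (pverts G) (signed_laplacian 1 G) e l"
  shows "signless_laplacian_eigenvalues G = image_mset l (mset_set (pverts G))"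
proof -
  note vs = vertex_list[OF pair_finite_verts]
  have "degree_matrix G + adjacency_matrix G = mat (length (vertex_list G)) (length (vertex_list G))
      (\<lambda>(i, j). signed_laplacian 1 G (vertex_list G ! i) (vertex_list G ! j))"
    using vs by (intro eq_matI)
      (auto simp: degree_matrix_def adjacency_matrix_def signed_laplacian_def adj_def
        out_degree_eq_deg nth_eq_iff_index_eq)
  then show ?thesis
    using eigenbasis_spectrum[OF vs(1,2) assms] by (simp add: signless_laplacian_eigenvalues_def)
qed

lemma smallest_signless_eigenvalue_le:
  assumes "eigenbasis (pverts G) (signed_laplacian 1 G) e l" "j \<in> pverts G"
  shows "smallest_signless_eigenvalue G \<le> l j"
  using assms(2) pair_finite_verts
  by (simp add: smallest_signless_eigenvalue_def signless_laplacian_eigenvalues_eq[OF assms(1)])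

lemma card_parcs: "real (card (parcs G)) = (\<Sum>u\<in>pverts G. deg G u)"
proof -
  have "parcs G = (\<Union>u\<in>pverts G. out_arcs (with_proj G) u)"
    using in_arcsD1 by (auto simp: out_arcs_def)
  then have "card (parcs G) = (\<Sum>u\<in>pverts G. out_degree (with_proj G) u)"
    using pair_finite_verts pair_finite_arcs unfolding out_degree_def
    by (subst card_UN_disjoint[symmetric]) (auto simp: out_arcs_def)
  then show ?thesis by (simp add: out_degree_eq_deg)
qed

lemma handshake: "2 * real (num_edges G) = (\<Sum>u\<in>pverts G. deg G u)"
proof -
  let ?edge = "\<lambda>(u, v). {u, v}"
  have "card (parcs G) = (\<Sum>E\<in>?edge ` parcs G. card {a \<in> parcs G. ?edge a = E})"
    using sum.image_gen[OF pair_finite_arcs, of "\<lambda>_. 1::nat" ?edge] by simp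
  also have "\<dots> = (\<Sum>E\<in>?edge ` parcs G. 2)"
  proof (rule sum.cong[OF refl])
    fix E assume "E \<in> ?edge ` parcs G"
    then obtain u v where uv: "(u, v) \<in> parcs G" "E = {u, v}" by auto
    then have "{a \<in> parcs G. ?edge a = E} = {(u, v), (v, u)}"
      using parcs_sym by (auto simp: doubleton_eq_iff)
    moreover have "u \<noteq> v" using pair_no_loops[OF uv(1)] by simp
    ultimately show "card {a \<in> parcs G. ?edge a = E} = 2" by simp
  qed
  finally show ?thesis using card_parcs by (simp add: num_edges_def)
qed

lemma laplacian_energy_eq:
  assumes "eigenbasis (pverts G) (signed_laplacian (- 1) G) e l"
  shows "laplacian_energy G = (\<Sum>j\<in>pverts G. \<bar>l j - avg_degree G\<bar>)"
  by (simp add: laplacian_energy_def laplacian_eigenvalues_eq[OF assms] handshake avg_degree_def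
      num_verts_def multiset.map_comp comp_def sum_unfold_sum_mset)

end

section \<open>An upper bound for the spectra\<close>

context pair_graph
begin

lemma deg_le:
  assumes "u \<in> pverts G"
  shows "deg G u \<le> real (card (pverts G)) - 1"
proof -
  have "deg G u = (\<Sum>v\<in>pverts G - {u}. adj G u v)"
    unfolding deg_def using assms pair_finite_verts by (simp add: sum.remove adj_self)
  also have "\<dots> \<le> (\<Sum>v\<in>pverts G - {u}. 1)"
    by (rule sum_mono) (simp add: adj_def)
  also have "\<dots> = real (card (pverts G)) - 1"
    using card_Suc_Diff1[OF pair_finite_verts assms] by simp
  finally show ?thesis .
qed

lemma deg_ge_1:
  assumes "(u, v) \<in> parcs G"
  shows "1 \<le> deg G u" "1 \<le> deg G v"
proof -
  have *: "1 \<le> deg G a" if "(a, b) \<in> parcs G" for a b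
  proof -
    have "adj G a b \<le> deg G a"
      unfolding deg_def using that in_arcsD2 pair_finite_verts
      by (intro member_le_sum) (auto simp: adj_nonneg)
    then show ?thesis using that by (simp add: adj_def)
  qed
  show "1 \<le> deg G u" "1 \<le> deg G v" using * assms parcs_sym by blast+
qed

text \<open>
  A positive weight \<open>w\<close> with \<open>(D + A) w \<le> c w\<close>, where \<open>c = a + n - 1\<close>, from which
  \<open>eigenvalue_le\<close> bounds the spectra. The weight is the degree, replaced by
  \<open>1\<close> at isolated vertices to keep it positive. At a vertex of degree \<open>d \<ge> 1\<close> the claim is that the
  sum \<open>S\<close> of the neighbouring degrees is at most \<open>d (c - d)\<close>. Since \<open>S \<le> n a - d\<close> (all other degrees)
  and \<open>S \<le> d (n - 1)\<close> (each of the \<open>d\<close> neighbours), the convex combination of these two bounds with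
  coefficients \<open>d / n\<close> and \<open>1 - d / n\<close> bounds \<open>S\<close>, and it equals \<open>d (c - d)\<close>.
\<close>

lemma signless_laplacian_subinvariant_weight:
  assumes u: "u \<in> pverts G"
  shows "deg G u * max (deg G u) 1 + (\<Sum>v\<in>pverts G. adj G u v * max (deg G v) 1)
    \<le> (avg_degree G + real (card (pverts G)) - 1) * max (deg G u) 1"
proof (cases "\<exists>v. (u, v) \<in> parcs G")
  case False
  then have "deg G u = 0" "(\<Sum>v\<in>pverts G. adj G u v * max (deg G v) 1) = 0"
    by (simp_all add: deg_def adj_def)
  moreover have "0 \<le> avg_degree G" by (simp add: avg_degree_def sum_nonneg deg_nonneg)
  moreover have "1 \<le> card (pverts G)"
    using card_Suc_Diff1[OF pair_finite_verts u] by simp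
  ultimately show ?thesis by simp
next
  case True
  define n where "n = real (card (pverts G))"
  define d where "d = deg G u"
  define a where "a = avg_degree G"
  define S where "S = (\<Sum>v\<in>pverts G. adj G u v * deg G v)"
  have d: "1 \<le> d" using True deg_ge_1 by (auto simp: d_def)
  have dn: "d \<le> n - 1" using deg_le[OF u] by (simp add: d_def n_def)
  have S: "(\<Sum>v\<in>pverts G. adj G u v * max (deg G v) 1) = S"
    unfolding S_def by (intro sum.cong refl) (auto simp: adj_def dest: deg_ge_1)
  have na: "n * a = (\<Sum>v\<in>pverts G. deg G v)"
    using d dn by (simp add: n_def a_def avg_degree_def)
  have S1: "S \<le> n * a - d"
  proof -
    have "S = (\<Sum>v\<in>pverts G - {u}. adj G u v * deg G v)"
      unfolding S_def using u pair_finite_verts by (simp add: sum.remove adj_self)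
    also have "\<dots> \<le> (\<Sum>v\<in>pverts G - {u}. deg G v)"
      by (rule sum_mono) (simp add: adj_def deg_nonneg)
    also have "\<dots> = n * a - d"
      using u pair_finite_verts by (simp add: na d_def sum_diff1)
    finally show ?thesis .
  qed
  have S2: "S \<le> d * (n - 1)"
  proof -
    have "S \<le> (\<Sum>v\<in>pverts G. adj G u v * (n - 1))"
      unfolding S_def by (intro sum_mono mult_left_mono) (auto simp: adj_nonneg n_def deg_le)
    then show ?thesis by (simp add: d_def deg_def sum_distrib_right)
  qed
  \<comment> \<open>The convex combination, multiplied by \<open>n\<close> to avoid fractions.\<close>
  have "n * S = d * S + (n - d) * S" by (simp add: algebra_simps)
  also have "\<dots> \<le> d * (n * a - d) + (n - d) * (d * (n - 1))"
    using d dn S1 S2 by (intro add_mono mult_left_mono) auto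
  also have "\<dots> = n * (d * (a + n - 1 - d))" by (simp add: algebra_simps)
  finally have "S \<le> d * (a + n - 1 - d)" using d dn by simp
  then have "d * d + S \<le> (a + n - 1) * d" by (simp add: algebra_simps)
  then show ?thesis using d unfolding S by (simp add: d_def a_def n_def max_def)
qed

text \<open>
  Compare the eigenvector with the weight \<open>w\<close> at a vertex \<open>u\<close> where \<open>\<bar>x u\<bar> / w u\<close> is largest: the
  eigenvalue equation there gives \<open>\<bar>l j - deg G u\<bar> w u \<le> (A w) u \<le> (c - deg G u) w u\<close>.
\<close>

lemma eigenvalue_le:
  assumes eb: "eigenbasis (pverts G) (signed_laplacian s G) e l" and j: "j \<in> pverts G"
    and s: "\<bar>s\<bar> \<le> 1"
  shows "l j \<le> avg_degree G + real (card (pverts G)) - 1"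
proof -
  define c where "c = avg_degree G + real (card (pverts G)) - 1"
  define w where "w v = max (deg G v) 1" for v
  define x where "x = e j"
  have w: "0 < w v" for v by (simp add: w_def)
  define r where "r v = \<bar>x v\<bar> / w v" for v
  define M where "M = Max (r ` pverts G)"
  have "M \<in> r ` pverts G"
    unfolding M_def using j pair_finite_verts by (intro Max_in) auto
  then obtain u where u: "u \<in> pverts G" "M = r u" by blast
  have le: "\<bar>x v\<bar> \<le> M * w v" if "v \<in> pverts G" for v
  proof -
    have "r v \<le> M" unfolding M_def using that pair_finite_verts by simp
    then show ?thesis using w[of v] by (simp add: r_def field_simps)
  qed
  have xu: "\<bar>x u\<bar> = M * w u" using u w[of u] by (simp add: r_def)
  have "M \<noteq> 0"
  proof
    assume "M = 0"
    then have "x v = 0" if "v \<in> pverts G" for v using le[OF that] by simp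
    then have "(\<Sum>v\<in>pverts G. e j v * e j v) = 0" by (simp add: x_def)
    then show False using eigenbasis_orthonormal[OF eb j j] by simp
  qed
  moreover have "0 \<le> M" using u w[of u] by (simp add: r_def)
  ultimately have M: "0 < M" by simp
  have "l j * x u = deg G u * x u + s * (\<Sum>v\<in>pverts G. adj G u v * x v)"
    using eigenbasis_eigen[OF eb j u(1)] signed_laplacian_apply[OF pair_finite_verts u(1)]
    by (simp add: x_def)
  then have "(l j - deg G u) * x u = s * (\<Sum>v\<in>pverts G. adj G u v * x v)"
    by (simp add: algebra_simps)
  then have "\<bar>l j - deg G u\<bar> * \<bar>x u\<bar> = \<bar>s\<bar> * \<bar>\<Sum>v\<in>pverts G. adj G u v * x v\<bar>"
    by (metis abs_mult)
  also have "\<dots> \<le> \<bar>\<Sum>v\<in>pverts G. adj G u v * x v\<bar>"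
    using s by (simp add: mult_left_le_one_le)
  also have "\<dots> \<le> (\<Sum>v\<in>pverts G. adj G u v * \<bar>x v\<bar>)"
    by (rule order_trans[OF sum_abs]) (simp add: abs_mult adj_nonneg)
  also have "\<dots> \<le> (\<Sum>v\<in>pverts G. adj G u v * (M * w v))"
    by (intro sum_mono mult_left_mono le) (auto simp: adj_nonneg)
  also have "\<dots> = M * (\<Sum>v\<in>pverts G. adj G u v * w v)"
    by (simp add: sum_distrib_left mult.left_commute)
  also have "\<dots> \<le> M * ((c - deg G u) * w u)"
    using signless_laplacian_subinvariant_weight[OF u(1)] M
    by (intro mult_left_mono) (simp_all add: w_def c_def algebra_simps)
  finally have "\<bar>l j - deg G u\<bar> * (M * w u) \<le> (c - deg G u) * (M * w u)"
    by (simp add: xu ac_simps)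
  then have "\<bar>l j - deg G u\<bar> \<le> c - deg G u"
    using M w[of u] by simp
  then show ?thesis by (simp add: c_def)
qed

end

section \<open>The extended double cover\<close>

lemma pverts_extended_double_cover [simp]:
  "pverts (extended_double_cover G) = pverts G <+> pverts G"
  by (simp add: extended_double_cover_def)

lemma adj_extended_double_cover:
  assumes "pair_graph G" "u \<in> pverts G" "v \<in> pverts G"
  shows "adj (extended_double_cover G) (Inl u) (Inl v) = 0"
    "adj (extended_double_cover G) (Inr u) (Inr v) = 0"
    "adj (extended_double_cover G) (Inl u) (Inr v) = (if u = v then 1 else 0) + adj G u v"
    "adj (extended_double_cover G) (Inr u) (Inl v) = (if u = v then 1 else 0) + adj G u v"
  using assms pair_graph.adj_self[OF assms(1), of u] pair_graph.parcs_sym[OF assms(1), of u v]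
  by (auto simp: adj_def extended_double_cover_def split: if_splits)

lemma deg_extended_double_cover:
  assumes "pair_graph G" "u \<in> pverts G"
  shows "deg (extended_double_cover G) (Inl u) = deg G u + 1"
    "deg (extended_double_cover G) (Inr u) = deg G u + 1"
  using assms pair_fin_digraph.pair_finite_verts[of G]
  by (simp_all add: deg_def sum.Plus adj_extended_double_cover sum.distrib
      pair_graph_def pair_digraph_def)

text \<open>
  Exchanging the two sides is a symmetry of the cover, whose Laplacian is \<open>D + I\<close> on the diagonal blocks and
  \<open>- (A + I)\<close> off them. A vector \<open>(x, x)\<close> is mapped to \<open>(y, y)\<close> with \<open>y = (D - A) x\<close>, and \<open>(x, - x)\<close> to
  \<open>(y, - y)\<close> with \<open>y = (D + A + 2 I) x\<close>. The factor \<open>1 / sqrt 2\<close> normalises.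
\<close>

lemma eigenbasis_extended_double_cover:
  assumes G: "pair_graph G"
    and L: "eigenbasis (pverts G) (signed_laplacian (- 1) G) e l"
    and Q: "eigenbasis (pverts G) (signed_laplacian 1 G) q t"
  shows "eigenbasis (pverts (extended_double_cover G)) (signed_laplacian (- 1) (extended_double_cover G))
    (case_sum (\<lambda>j. case_sum (\<lambda>v. e j v / sqrt 2) (\<lambda>v. e j v / sqrt 2))
              (\<lambda>j. case_sum (\<lambda>v. q j v / sqrt 2) (\<lambda>v. - q j v / sqrt 2)))
    (case_sum l (\<lambda>j. t j + 2))"
    (is "eigenbasis _ _ ?e ?l")
proof -
  interpret pair_graph G by fact
  interpret C: pair_graph "extended_double_cover G" by (rule pair_graph_extended_double_cover[OF G])
  note fin = pair_finite_verts
  note sumC = sum.Plus[OF fin fin]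
  have half: "sqrt 2 * sqrt 2 = (2 :: real)" by simp
  have apply_adj: "(\<Sum>v\<in>pverts G. ((if u = v then 1 else 0) + adj G u v) * x v)
      = x u + (\<Sum>v\<in>pverts G. adj G u v * x v)" if "u \<in> pverts G" for u and x :: "'a \<Rightarrow> real"
  proof -
    have "(\<Sum>v\<in>pverts G. ((if u = v then 1 else 0) + adj G u v) * x v)
      = (\<Sum>v\<in>pverts G. (if u = v then x v else 0) + adj G u v * x v)"
      by (intro sum.cong refl) (simp add: algebra_simps)
    then show ?thesis using that fin by (simp add: sum.distrib)
  qed
  have Le: "(\<Sum>v\<in>pverts G. adj G u v * e j v) = (deg G u - l j) * e j u"
    if "u \<in> pverts G" "j \<in> pverts G" for u j
    using eigenbasis_eigen[OF L that(2,1)] signed_laplacian_apply[OF fin that(1), of "- 1" "e j"]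
    by (simp add: algebra_simps)
  have Qe: "(\<Sum>v\<in>pverts G. adj G u v * q j v) = (t j - deg G u) * q j u"
    if "u \<in> pverts G" "j \<in> pverts G" for u j
    using eigenbasis_eigen[OF Q that(2,1)] signed_laplacian_apply[OF fin that(1), of 1 "q j"]
    by (simp add: algebra_simps)
  show ?thesis
    unfolding eigenbasis_def
  proof (intro conjI ballI)
    fix i j assume "i \<in> pverts (extended_double_cover G)" "j \<in> pverts (extended_double_cover G)"
    then show "(\<Sum>v\<in>pverts (extended_double_cover G). ?e i v * ?e j v) = (if i = j then 1 else 0)"
      using eigenbasis_orthonormal[OF L] eigenbasis_orthonormal[OF Q]
      by (auto simp: sumC half sum_negf simp flip: sum_divide_distrib split: if_splits)
  next
    fix j u assume ju: "j \<in> pverts (extended_double_cover G)" "u \<in> pverts (extended_double_cover G)"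
    have "(\<Sum>v\<in>pverts (extended_double_cover G). signed_laplacian (- 1) (extended_double_cover G) u v * ?e j v)
        = deg (extended_double_cover G) u * ?e j u
          + (- 1) * (\<Sum>v\<in>pverts (extended_double_cover G). adj (extended_double_cover G) u v * ?e j v)"
      by (rule signed_laplacian_apply[OF C.pair_finite_verts ju(2)])
    also have "\<dots> = ?l j * ?e j u"
      using ju
      by (auto simp: sumC adj_extended_double_cover[OF G] deg_extended_double_cover[OF G]
          apply_adj sum_negf Le Qe simp flip: sum_divide_distrib) (auto simp: field_simps)
    finally show "(\<Sum>v\<in>pverts (extended_double_cover G).
        signed_laplacian (- 1) (extended_double_cover G) u v * ?e j v) = ?l j * ?e j u" .
  qed
qed

section \<open>Cartesian products\<close>

lemma pverts_cartesian_product [simp]: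
  "pverts (cartesian_product H1 H2) = pverts H1 \<times> pverts H2"
  by (simp add: cartesian_product_def)

lemma adj_cartesian_product:
  assumes "pair_graph H1" "pair_graph H2"
    and "u \<in> pverts H1" "u' \<in> pverts H1" "w \<in> pverts H2" "w' \<in> pverts H2"
  shows "adj (cartesian_product H1 H2) (u, w) (u', w')
    = (if w = w' then adj H1 u u' else 0) + (if u = u' then adj H2 w w' else 0)"
  using assms(3-) pair_graph.adj_self[OF assms(1), of u] pair_graph.adj_self[OF assms(2), of w]
  by (auto simp: adj_def cartesian_product_def split: if_splits)

lemma sum_adj_cartesian_product:
  assumes H1: "pair_graph H1" and H2: "pair_graph H2" and u: "u \<in> pverts H1" and w: "w \<in> pverts H2"
  shows "(\<Sum>v\<in>pverts (cartesian_product H1 H2). adj (cartesian_product H1 H2) (u, w) v * x v)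
    = (\<Sum>u'\<in>pverts H1. adj H1 u u' * x (u', w)) + (\<Sum>w'\<in>pverts H2. adj H2 w w' * x (u, w'))"
proof -
  interpret H1: pair_graph H1 by fact
  interpret H2: pair_graph H2 by fact
  note fin = H1.pair_finite_verts H2.pair_finite_verts
  have "(\<Sum>v\<in>pverts (cartesian_product H1 H2). adj (cartesian_product H1 H2) (u, w) v * x v)
    = (\<Sum>u'\<in>pverts H1. \<Sum>w'\<in>pverts H2. (if w = w' then adj H1 u u' * x (u', w) else 0)
        + (if u = u' then adj H2 w w' * x (u, w') else 0))"
    unfolding pverts_cartesian_product sum.cartesian_product'
    by (intro sum.cong refl) (use u w in \<open>auto simp: adj_cartesian_product[OF H1 H2] distrib_right\<close>)
  also have "\<dots> = (\<Sum>u'\<in>pverts H1. adj H1 u u' * x (u', w)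
        + (if u = u' then (\<Sum>w'\<in>pverts H2. adj H2 w w' * x (u, w')) else 0))"
    using fin w by (intro sum.cong refl) (simp add: sum.distrib)
  finally show ?thesis using fin u by (simp add: sum.distrib)
qed

lemma deg_cartesian_product:
  assumes "pair_graph H1" "pair_graph H2" "u \<in> pverts H1" "w \<in> pverts H2"
  shows "deg (cartesian_product H1 H2) (u, w) = deg H1 u + deg H2 w"
  using sum_adj_cartesian_product[OF assms, of "\<lambda>_. 1"] by (simp add: deg_def)

text \<open>
  The signed Laplacian of the product is a Kronecker sum, so tensor products of eigenvectors are
  eigenvectors and their eigenvalues add.
\<close>

lemma eigenbasis_cartesian_product:
  assumes H1: "pair_graph H1" and H2: "pair_graph H2"
    and e: "eigenbasis (pverts H1) (signed_laplacian s H1) e l"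
    and f: "eigenbasis (pverts H2) (signed_laplacian s H2) f k"
  shows "eigenbasis (pverts (cartesian_product H1 H2)) (signed_laplacian s (cartesian_product H1 H2))
    (\<lambda>(i, j) (u, w). e i u * f j w) (\<lambda>(i, j). l i + k j)"
    (is "eigenbasis _ _ ?e ?l")
proof -
  interpret H1: pair_graph H1 by fact
  interpret H2: pair_graph H2 by fact
  interpret P: pair_graph "cartesian_product H1 H2" by (rule pair_graph_cartesian_product[OF H1 H2])
  show ?thesis
    unfolding eigenbasis_def
  proof (intro conjI ballI)
    fix x y assume "x \<in> pverts (cartesian_product H1 H2)" "y \<in> pverts (cartesian_product H1 H2)"
    then obtain i j i' j' where ij: "x = (i, j)" "y = (i', j')"
      "i \<in> pverts H1" "j \<in> pverts H2" "i' \<in> pverts H1" "j' \<in> pverts H2" by auto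
    have "(\<Sum>v\<in>pverts (cartesian_product H1 H2). ?e x v * ?e y v)
        = (\<Sum>u\<in>pverts H1. e i u * e i' u) * (\<Sum>w\<in>pverts H2. f j w * f j' w)"
      unfolding pverts_cartesian_product sum.cartesian_product' sum_product
      by (simp add: ij ac_simps)
    then show "(\<Sum>v\<in>pverts (cartesian_product H1 H2). ?e x v * ?e y v) = (if x = y then 1 else 0)"
      using ij by (simp add: eigenbasis_orthonormal[OF e] eigenbasis_orthonormal[OF f])
    obtain u w where uw: "y = (u, w)" "u \<in> pverts H1" "w \<in> pverts H2" using ij by blast
    have "(\<Sum>v\<in>pverts (cartesian_product H1 H2). signed_laplacian s (cartesian_product H1 H2) y v * ?e x v)
        = deg (cartesian_product H1 H2) y * ?e x y
          + s * (\<Sum>v\<in>pverts (cartesian_product H1 H2). adj (cartesian_product H1 H2) y v * ?e x v)"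
      by (rule signed_laplacian_apply[OF P.pair_finite_verts]) (use uw in simp)
    also have "\<dots> = (deg H1 u * e i u + s * (\<Sum>u'\<in>pverts H1. adj H1 u u' * e i u')) * f j w
        + e i u * (deg H2 w * f j w + s * (\<Sum>w'\<in>pverts H2. adj H2 w w' * f j w'))"
      unfolding uw(1) sum_adj_cartesian_product[OF H1 H2 uw(2,3)] deg_cartesian_product[OF H1 H2 uw(2,3)]
      by (simp add: ij algebra_simps sum_distrib_left sum_distrib_right)
    also have "\<dots> = ?l x * ?e x y"
      unfolding signed_laplacian_apply[OF H1.pair_finite_verts uw(2), symmetric]
        signed_laplacian_apply[OF H2.pair_finite_verts uw(3), symmetric]
        eigenbasis_eigen[OF e ij(3) uw(2)] eigenbasis_eigen[OF f ij(4) uw(3)]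
      by (simp add: ij(1) uw(1) algebra_simps)
    finally show "(\<Sum>v\<in>pverts (cartesian_product H1 H2).
      signed_laplacian s (cartesian_product H1 H2) y v * ?e x v) = ?l x * ?e x y" .
  qed
qed

section \<open>Products with a complete graph\<close>

text \<open>
  The Laplacian of the complete graph is \<open>p I - J\<close> with the all-ones matrix \<open>J\<close>. For an eigenvector
  with coordinate sum \<open>S\<close> and eigenvalue \<open>\<kappa>\<close>, summing the coordinates of the eigenvalue equation
  gives \<open>\<kappa> S = 0\<close>; if \<open>S = 0\<close>, then \<open>J\<close> annihilates the vector and \<open>\<kappa> = p\<close>. The multiplicities are
  encoded in the trace.
\<close>

lemma complete_graph_eigenvalues:
  assumes K: "pair_graph K" "complete_digraph p (with_proj K)"
    and eb: "eigenbasis (pverts K) (signed_laplacian (- 1) K) f k"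
  shows "card (pverts K) = p"
    and "\<And>w. w \<in> pverts K \<Longrightarrow> deg K w = real p - 1"
    and "\<And>j. j \<in> pverts K \<Longrightarrow> k j = 0 \<or> k j = real p"
    and "(\<Sum>j\<in>pverts K. k j) = real p * (real p - 1)"
proof -
  interpret pair_graph K by fact
  note fin = pair_finite_verts
  show p: "card (pverts K) = p"
    using K(2) by (simp add: complete_digraph_def)
  have arcs: "(w, w') \<in> parcs K \<longleftrightarrow> w \<in> pverts K \<and> w' \<in> pverts K \<and> w \<noteq> w'" for w w'
    using K(2) by (simp add: complete_digraph_def)
  have sum_adj: "(\<Sum>w'\<in>pverts K. adj K w w' * x w') = (\<Sum>w'\<in>pverts K. x w') - x w"
    if w: "w \<in> pverts K" for w x
  proof -
    have "(\<Sum>w'\<in>pverts K. adj K w w' * x w') = (\<Sum>w'\<in>pverts K. x w' - (if w = w' then x w' else 0))"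
      using w by (intro sum.cong refl) (auto simp: adj_def arcs)
    then show ?thesis using fin w by (simp add: sum_subtractf)
  qed
  show deg: "deg K w = real p - 1" if "w \<in> pverts K" for w
    using sum_adj[OF that, of "\<lambda>_. 1"] by (simp add: deg_def p)
  show "k j = 0 \<or> k j = real p" if j: "j \<in> pverts K" for j
  proof -
    define S where "S = (\<Sum>w\<in>pverts K. f j w)"
    have eq: "k j * f j w = real p * f j w - S" if w: "w \<in> pverts K" for w
      using eigenbasis_eigen[OF eb j w] signed_laplacian_apply[OF fin w, of "- 1" "f j"]
      unfolding sum_adj[OF w] deg[OF w] S_def by (simp add: left_diff_distrib)
    have "k j * S = (\<Sum>w\<in>pverts K. real p * f j w - S)"
      unfolding S_def[THEN arg_cong[where f = "(*) (k j)"]] sum_distrib_left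
      by (intro sum.cong refl eq)
    also have "\<dots> = 0" by (simp add: sum_subtractf p S_def flip: sum_distrib_left)
    finally have "k j = 0 \<or> S = 0" by simp
    moreover have "k j = real p" if "S = 0"
    proof -
      have "\<exists>w\<in>pverts K. f j w \<noteq> 0"
        using eigenbasis_orthonormal[OF eb j j] by (auto intro: ccontr)
      then show ?thesis using eq that by auto
    qed
    ultimately show ?thesis by blast
  qed
  show "(\<Sum>j\<in>pverts K. k j) = real p * (real p - 1)"
    using eigenbasis_signed_laplacian_trace[OF eb] by (simp add: deg p)
qed

lemma complete_digraph_imp_pair_graph:
  assumes "complete_digraph p (with_proj K)"
  shows "pair_graph K"
proof -
  interpret graph "with_proj K" using assms by (simp add: complete_digraph_def)
  show ?thesis
    using wellformed finite_verts finite_arcs no_loops sym_arcs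
    by unfold_locales auto
qed

text \<open>
  On the two points \<open>0\<close> and \<open>p\<close> every function is affine, so its sum over the \<open>k j\<close> depends only on
  their number and their total. Applied to the spectrum of \<open>K\<^sub>p\<close>, this says that \<open>0\<close> occurs once and
  \<open>p\<close> occurs \<open>p - 1\<close> times.
\<close>

lemma sum_two_valued:
  fixes k :: "'j \<Rightarrow> real" and h :: "real \<Rightarrow> real"
  assumes J: "real (card J) = p" and p: "p \<noteq> 0"
    and k: "\<And>j. j \<in> J \<Longrightarrow> k j = 0 \<or> k j = p" and sum: "(\<Sum>j\<in>J. k j) = p * (p - 1)"
  shows "(\<Sum>j\<in>J. h (k j)) = h 0 + (p - 1) * h p"
proof -
  define c where "c = (h p - h 0) / p"
  have "(\<Sum>j\<in>J. h (k j)) = (\<Sum>j\<in>J. h 0 + k j * c)"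
    using k p by (intro sum.cong refl) (fastforce simp: c_def)
  also have "\<dots> = p * h 0 + (p * (p - 1)) * c"
    by (simp add: sum.distrib J sum flip: sum_distrib_right)
  also have "\<dots> = h 0 + (p - 1) * h p"
    using p by (simp add: c_def field_simps)
  finally show ?thesis .
qed

text \<open>
  The energy is summed over pairs of an eigenvalue \<open>r x\<close> of the cover and an eigenvalue \<open>k j\<close> of the
  complete graph; the inner sum collapses by \<open>sum_two_valued\<close>. The bounds \<open>l_le\<close>, \<open>t_le\<close> and
  \<open>t_ge\<close> then fix every sign except in the terms \<open>\<bar>l j - a\<bar>\<close>, which make up the energy of \<open>G\<close>.
\<close>

lemma laplacian_energy_double_cover_times_complete:
  assumes G: "pair_graph G" and K: "complete_digraph p (with_proj K)"
    and ne: "pverts G \<noteq> {}"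
    and p: "num_verts G + 1 \<le> p"
    and small: "avg_degree G - 2 \<le> smallest_signless_eigenvalue G"
  shows "laplacian_energy (cartesian_product (extended_double_cover G) K)
    = (real p - 1) * (laplacian_energy G + 4 * real (num_verts G))"
proof -
  interpret pair_graph G by fact
  have gK: "pair_graph K" by (rule complete_digraph_imp_pair_graph[OF K])
  interpret K: pair_graph K by (fact gK)
  let ?C = "extended_double_cover G"
  let ?H = "cartesian_product ?C K"
  have gC: "pair_graph ?C" by (rule pair_graph_extended_double_cover[OF G])
  interpret H: pair_graph ?H by (rule pair_graph_cartesian_product[OF gC gK])
  define n where "n = real (card (pverts G))"
  define a where "a = avg_degree G"
  have n: "n > 0" using ne pair_finite_verts by (simp add: n_def card_gt_0_iff)
  have pn: "n + 1 \<le> real p" using p by (simp add: n_def num_verts_def)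
  have na: "(\<Sum>u\<in>pverts G. deg G u) = n * a" using n by (simp add: a_def avg_degree_def n_def)
  obtain e l where L: "eigenbasis (pverts G) (signed_laplacian (- 1) G) e l"
    by (rule eigenbasis_signed_laplacian_exists)
  obtain q t where Q: "eigenbasis (pverts G) (signed_laplacian 1 G) q t"
    by (rule eigenbasis_signed_laplacian_exists)
  obtain f k where M: "eigenbasis (pverts K) (signed_laplacian (- 1) K) f k"
    by (rule K.eigenbasis_signed_laplacian_exists)
  note kK = complete_graph_eigenvalues[OF gK K M]
  define r where "r = case_sum l (\<lambda>j. t j + 2)"
  have avgH: "avg_degree ?H = a + real p"
  proof -
    have "(\<Sum>x\<in>pverts ?H. deg ?H x) = (\<Sum>u\<in>pverts ?C. \<Sum>w\<in>pverts K. deg ?C u + (real p - 1))"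
      unfolding pverts_cartesian_product sum.cartesian_product'
      by (intro sum.cong refl) (simp add: deg_cartesian_product[OF gC gK] kK(2))
    also have "\<dots> = real p * (\<Sum>u\<in>pverts ?C. deg ?C u + (real p - 1))"
      by (simp only: sum_constant kK(1) sum_distrib_left)
    also have "(\<Sum>u\<in>pverts ?C. deg ?C u + (real p - 1)) = 2 * (\<Sum>u\<in>pverts G. deg G u + real p)"
      unfolding pverts_extended_double_cover sum.Plus[OF pair_finite_verts pair_finite_verts]
      by (simp add: deg_extended_double_cover[OF G] cong: sum.cong)
    also have "\<dots> = 2 * n * (a + real p)"
      by (simp add: sum.distrib na n_def algebra_simps)
    finally have "(\<Sum>x\<in>pverts ?H. deg ?H x) = (2 * n * real p) * (a + real p)" by simp
    moreover have "real (card (pverts ?H)) = 2 * n * real p"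
      using pair_finite_verts by (simp add: card_cartesian_product card_Plus kK(1) n_def)
    ultimately show ?thesis
      using n pn unfolding avg_degree_def by simp
  qed
  have sum_l: "(\<Sum>j\<in>pverts G. l j) = n * a"
    using eigenbasis_signed_laplacian_trace[OF L] na by simp
  have sum_t: "(\<Sum>j\<in>pverts G. t j) = n * a"
    using eigenbasis_signed_laplacian_trace[OF Q] na by simp
  have l_le: "l j \<le> a + real p" if "j \<in> pverts G" for j
    using eigenvalue_le[OF L that] pn by (simp add: a_def n_def)
  have t_le: "t j + 2 \<le> a + real p" if "j \<in> pverts G" for j
    using eigenvalue_le[OF Q that] pn by (simp add: a_def n_def)
  have t_ge: "a \<le> t j + 2" if "j \<in> pverts G" for j
    using smallest_signless_eigenvalue_le[OF Q that] small by (simp add: a_def)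
  have "laplacian_energy ?H = (\<Sum>x\<in>pverts ?C. \<Sum>j\<in>pverts K. \<bar>r x + k j - (a + real p)\<bar>)"
    unfolding H.laplacian_energy_eq[OF eigenbasis_cartesian_product[OF gC gK
          eigenbasis_extended_double_cover[OF G L Q] M]]
      pverts_cartesian_product sum.cartesian_product' avgH r_def
    by simp
  also have "\<dots> = (\<Sum>x\<in>pverts ?C. \<bar>r x - (a + real p)\<bar> + (real p - 1) * \<bar>r x - a\<bar>)"
  proof (intro sum.cong refl)
    fix x
    show "(\<Sum>j\<in>pverts K. \<bar>r x + k j - (a + real p)\<bar>)
        = \<bar>r x - (a + real p)\<bar> + (real p - 1) * \<bar>r x - a\<bar>"
      using sum_two_valued[OF _ _ kK(3) kK(4), of "\<lambda>y. \<bar>r x + y - (a + real p)\<bar>"] kK(1) pn n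
      by simp
  qed
  also have "\<dots> = (\<Sum>j\<in>pverts G. \<bar>l j - (a + real p)\<bar> + (real p - 1) * \<bar>l j - a\<bar>)
      + (\<Sum>j\<in>pverts G. \<bar>t j + 2 - (a + real p)\<bar> + (real p - 1) * \<bar>t j + 2 - a\<bar>)"
    using pair_finite_verts by (simp add: sum.Plus r_def)
  also have "(\<Sum>j\<in>pverts G. \<bar>l j - (a + real p)\<bar> + (real p - 1) * \<bar>l j - a\<bar>)
      = n * real p + (real p - 1) * laplacian_energy G"
  proof -
    have "(\<Sum>j\<in>pverts G. \<bar>l j - (a + real p)\<bar>) = (\<Sum>j\<in>pverts G. (a + real p) - l j)"
      using l_le by (intro sum.cong refl) auto
    also have "\<dots> = n * real p" by (simp add: sum_subtractf sum_l n_def algebra_simps)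
    finally show ?thesis
      by (simp add: sum.distrib laplacian_energy_eq[OF L] a_def flip: sum_distrib_left)
  qed
  also have "(\<Sum>j\<in>pverts G. \<bar>t j + 2 - (a + real p)\<bar> + (real p - 1) * \<bar>t j + 2 - a\<bar>)
      = (\<Sum>j\<in>pverts G. (a + real p - 2 - t j) + (real p - 1) * (t j + 2 - a))"
  proof (intro sum.cong refl)
    fix j assume "j \<in> pverts G"
    from t_le[OF this] t_ge[OF this]
    show "\<bar>t j + 2 - (a + real p)\<bar> + (real p - 1) * \<bar>t j + 2 - a\<bar>
        = (a + real p - 2 - t j) + (real p - 1) * (t j + 2 - a)"
      by simp
  qed
  also have "\<dots> = n * (real p - 2) + (real p - 1) * (2 * n)"
  proof -
    have "(\<Sum>j\<in>pverts G. t j + 2 - a) = 2 * n"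
      by (simp add: sum.distrib sum_subtractf sum_t n_def)
    moreover have "(\<Sum>j\<in>pverts G. a + real p - 2 - t j) = n * (real p - 2)"
      by (simp add: sum_subtractf sum_t n_def algebra_simps)
    ultimately show ?thesis unfolding sum.distrib sum_distrib_left[symmetric] by simp
  qed
  finally show ?thesis by (simp add: n_def num_verts_def algebra_simps)
qed

theorem theorem4p10:
  fixes G1 :: "'a pair_pre_digraph" and G2 :: "'b pair_pre_digraph"
    and K :: "'c pair_pre_digraph" and n m p :: nat
  assumes "pair_graph G1" "Digraph_Component.connected (with_proj G1)" "\<not> bipartite G1"
    and "pair_graph G2" "Digraph_Component.connected (with_proj G2)" "\<not> bipartite G2"
    and "num_verts G1 = n" "num_edges G1 = m"
    and "num_verts G2 = n" "num_edges G2 = m"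
    and "p \<ge> n + 2" and "complete_digraph p (with_proj K)"
    and "min (smallest_signless_eigenvalue G1) (smallest_signless_eigenvalue G2)
           \<ge> 2 * real m / real n - 2"
  shows "laplacian_energy (cartesian_product (extended_double_cover G1) K) =
         laplacian_energy (cartesian_product (extended_double_cover G2) K)
     \<longleftrightarrow> laplacian_energy G1 = laplacian_energy G2"
proof -
  have ne: "pverts G1 \<noteq> {}" "pverts G2 \<noteq> {}"
    using \<open>Digraph_Component.connected (with_proj G1)\<close> \<open>Digraph_Component.connected (with_proj G2)\<close>
    by (auto simp: Digraph_Component.connected_def strongly_connected_def)
  have avg: "avg_degree G1 = 2 * real m / real n" "avg_degree G2 = 2 * real m / real n"
    using assms pair_graph.handshake[of G1] pair_graph.handshake[of G2]
    by (auto simp: avg_degree_def num_verts_def)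
  have "laplacian_energy (cartesian_product (extended_double_cover G1) K)
      = (real p - 1) * (laplacian_energy G1 + 4 * real n)"
    using laplacian_energy_double_cover_times_complete[OF assms(1,12) ne(1)] assms avg by simp
  moreover have "laplacian_energy (cartesian_product (extended_double_cover G2) K)
      = (real p - 1) * (laplacian_energy G2 + 4 * real n)"
    using laplacian_energy_double_cover_times_complete[OF assms(4,12) ne(2)] assms avg by simp
  ultimately show ?thesis using \<open>p \<ge> n + 2\<close> by simp
qed

end
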